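(* There exists a constant $\tau$ such that, for every $\beta\ge 0$, the mixing time $t_{\mathrm{mix}}$ of the logit dynamics with inverse noise $\beta$ for the CK game satisfies $t_{\mathrm{mix}}\le\tau$.
   Context: Logit dynamics: for a strategic game with $n$ players, finite strategy sets $S_i$ and utilities $u_i:\prod_j S_j\to\mathbb{R}$, and for $\beta\ge 0$, let $\sigma_i(y\mid\mathbf{x})=e^{\beta u_i(\mathbf{x}_{-i},y)}/\sum_{z\in S_i}e^{\beta u_i(\mathbf{x}_{-i},z)}$, where $(\mathbf{x}_{-i},y)$ is $\mathbf{x}$ with its $i$-th entry replaced by $y$. The logit dynamics with inverse noise $\beta$ is the Markov chain on $\Omega=\prod_j S_j$ which, from profile $\mathbf{x}$, selects a player $i$ uniformly at random and replaces $x_i$ by $y\in S_i$ with probability $\sigma_i(y\mid\mathbf{x})$. It is irreducible and aperiodic; let $P$ be its transition matrix and $\pi$ its unique stationary distribution. The mixing time is $t_{\mathrm{mix}}=\min\{t\in\mathbb{N}:\max_{\mathbf{x}\in\Omega}\|P^t(\mathbf{x},\cdot)-\pi\|_{\mathrm{TV}}\le 1/4\}$, where $\|\mu-\nu\|_{\mathrm{TV}}=\max_{A\subseteq\Omega}|\mu(A)-\nu(A)|$. The CK game: there are $3$ players, indexed by $i\in\{0,1,2\}$, and $6$ facilities $g_0,g_1,g_2,h_0,h_1,h_2$ (indices modulo $3$). Each player has strategies $0$ and $1$: with strategy $0$ player $i$ selects the facilities $g_i,h_i$; with strategy $1$ she selects the facilities $g_{i+1},h_{i-1},h_{i+1}$.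 In a profile, the cost of a facility is the number of players selecting it, and the utility of a player is minus the sum of the costs of the facilities she selects. *)

theory Defs
  imports Complex_Main "HOL-Library.FuncSet" "HOL-Library.Extended_Nat"
begin

text \<open>Transition matrices, and distributions, on a finite state space \<open>\<Omega>\<close> are real-valued functions;
  only their values on \<open>\<Omega>\<close> matter.\<close>

fun mat_power :: "'a set \<Rightarrow> ('a \<Rightarrow> 'a \<Rightarrow> real) \<Rightarrow> nat \<Rightarrow> 'a \<Rightarrow> 'a \<Rightarrow> real" where
  "mat_power \<Omega> P 0 x y = (if x = y then 1 else 0)"
| "mat_power \<Omega> P (Suc t) x y = (\<Sum>z\<in>\<Omega>. mat_power \<Omega> P t x z * P z y)"

text \<open>Vanishing outside \<open>\<Omega>\<close> makes a stationary distribution unique as a HOL function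
  whenever it is unique on \<open>\<Omega>\<close>.\<close>

definition is_stationary :: "'a set \<Rightarrow> ('a \<Rightarrow> 'a \<Rightarrow> real) \<Rightarrow> ('a \<Rightarrow> real) \<Rightarrow> bool" where
  "is_stationary \<Omega> P \<pi> \<longleftrightarrow>
     (\<forall>x\<in>\<Omega>. 0 \<le> \<pi> x) \<and> (\<forall>x. x \<notin> \<Omega> \<longrightarrow> \<pi> x = 0) \<and> (\<Sum>x\<in>\<Omega>. \<pi> x) = 1 \<and>
     (\<forall>y\<in>\<Omega>. (\<Sum>x\<in>\<Omega>. \<pi> x * P x y) = \<pi> y)"

definition stationary_distribution :: "'a set \<Rightarrow> ('a \<Rightarrow> 'a \<Rightarrow> real) \<Rightarrow> 'a \<Rightarrow> real" where
  "stationary_distribution \<Omega> P = (THE \<pi>. is_stationary \<Omega> P \<pi>)"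

definition tv_distance :: "'a set \<Rightarrow> ('a \<Rightarrow> real) \<Rightarrow> ('a \<Rightarrow> real) \<Rightarrow> real" where
  "tv_distance \<Omega> \<mu> \<nu> = Max ((\<lambda>A. \<bar>(\<Sum>x\<in>A. \<mu> x) - (\<Sum>x\<in>A. \<nu> x)\<bar>) ` Pow \<Omega>)"

text \<open>The infimum in \<^typ>\<open>enat\<close> is the minimum if some time qualifies, and is \<open>\<infinity>\<close> otherwise; hence a
  finite upper bound on the mixing time also asserts that the minimum exists.\<close>

definition mixing_time :: "'a set \<Rightarrow> ('a \<Rightarrow> 'a \<Rightarrow> real) \<Rightarrow> enat" where
  "mixing_time \<Omega> P = Inf (enat ` {t.
     Max ((\<lambda>x. tv_distance \<Omega> (mat_power \<Omega> P t x) (stationary_distribution \<Omega> P)) ` \<Omega>) \<le> 1 / 4})"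

text \<open>A game with player set \<open>{..<n}\<close> is given by strategy sets \<open>S i\<close> and utilities \<open>u i\<close>.\<close>

definition profiles :: "nat \<Rightarrow> (nat \<Rightarrow> 's set) \<Rightarrow> (nat \<Rightarrow> 's) set" where
  "profiles n S = (\<Pi>\<^sub>E i\<in>{..<n}. S i)"

definition logit_choice ::
  "(nat \<Rightarrow> 's set) \<Rightarrow> (nat \<Rightarrow> (nat \<Rightarrow> 's) \<Rightarrow> real) \<Rightarrow> real \<Rightarrow> nat \<Rightarrow> (nat \<Rightarrow> 's) \<Rightarrow> 's \<Rightarrow> real" where
  "logit_choice S u \<beta> i x y =
     exp (\<beta> * u i (x(i := y))) / (\<Sum>z\<in>S i. exp (\<beta> * u i (x(i := z))))"

definition logit_matrix ::
  "nat \<Rightarrow> (nat \<Rightarrow> 's set) \<Rightarrow> (nat \<Rightarrow> (nat \<Rightarrow> 's) \<Rightarrow> real) \<Rightarrow> real \<Rightarrow>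
   (nat \<Rightarrow> 's) \<Rightarrow> (nat \<Rightarrow> 's) \<Rightarrow> real" where
  "logit_matrix n S u \<beta> x x' =
     (\<Sum>i<n. 1 / real n * (\<Sum>y\<in>{y \<in> S i. x(i := y) = x'}. logit_choice S u \<beta> i x y))"

definition logit_mixing_time ::
  "nat \<Rightarrow> (nat \<Rightarrow> 's set) \<Rightarrow> (nat \<Rightarrow> (nat \<Rightarrow> 's) \<Rightarrow> real) \<Rightarrow> real \<Rightarrow> enat" where
  "logit_mixing_time n S u \<beta> = mixing_time (profiles n S) (logit_matrix n S u \<beta>)"

text \<open>Facilities \<open>g\<^sub>k\<close> and \<open>h\<^sub>k\<close> are used only for \<open>k < 3\<close>.\<close>

datatype facility = G nat | H nat

definition ck_strategies :: "nat \<Rightarrow> nat set" where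
  "ck_strategies i = {0, 1}"

text \<open>The index \<open>i - 1\<close> modulo 3 is written \<open>(i + 2) mod 3\<close> to avoid truncated subtraction.\<close>

definition ck_selects :: "nat \<Rightarrow> nat \<Rightarrow> facility set" where
  "ck_selects i s =
     (if s = 0 then {G i, H i}
      else {G ((i + 1) mod 3), H ((i + 2) mod 3), H ((i + 1) mod 3)})"

definition ck_cost :: "(nat \<Rightarrow> nat) \<Rightarrow> facility \<Rightarrow> nat" where
  "ck_cost x f = card {j. j < 3 \<and> f \<in> ck_selects j (x j)}"

definition ck_utility :: "nat \<Rightarrow> (nat \<Rightarrow> nat) \<Rightarrow> real" where
  "ck_utility i x = - (\<Sum>f\<in>ck_selects i (x i). real (ck_cost x f))"

end

theory Submission
  imports Defs
begin

text \<open>In the CK game, given the strategies \<open>p\<close> and \<open>q\<close> of the two other players, strategy 0 costs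
  player \<open>i\<close> exactly \<open>4 - 2 * (p + q)\<close> less than strategy 1. Hence strategy 0 is weakly dominant, and
  an updated player adopts it with probability at least 1/2 for every \<open>\<beta>\<close>. Whatever the initial
  profile, the all-zero profile is therefore reached in three steps with probability at least
  1/216. This is a Doeblin condition that does not depend on \<open>\<beta>\<close>: the three-step matrix contracts
  the \<open>\<ell>\<^sup>1\<close>-norm of signed measures of total mass 0 by the factor 215/216.\<close>

section \<open>Stochastic matrices and Doeblin's condition\<close>

definition stochastic_on :: "'a set \<Rightarrow> ('a \<Rightarrow> 'a \<Rightarrow> real) \<Rightarrow> bool" where
  "stochastic_on \<Omega> P \<longleftrightarrow>
     (\<forall>x\<in>\<Omega>. \<forall>y\<in>\<Omega>. 0 \<le> P x y) \<and> (\<forall>x\<in>\<Omega>. (\<Sum>y\<in>\<Omega>. P x y) = 1)"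

lemma stochastic_onD:
  assumes "stochastic_on \<Omega> P" "x \<in> \<Omega>"
  shows "y \<in> \<Omega> \<Longrightarrow> 0 \<le> P x y" and "(\<Sum>y\<in>\<Omega>. P x y) = 1"
  using assms by (auto simp: stochastic_on_def)

text \<open>Since \<open>f\<close> may be signed, this keeps differences of distributions at mass 0
  when the contraction is iterated.\<close>

lemma sum_vector_matrix:
  assumes "stochastic_on \<Omega> P"
  shows "(\<Sum>y\<in>\<Omega>. \<Sum>x\<in>\<Omega>. f x * P x y) = (\<Sum>x\<in>\<Omega>. f x)"
  by (subst sum.swap) (auto simp: sum_distrib_left[symmetric] stochastic_onD[OF assms] intro!: sum.cong)

lemma stochastic_on_mat_power:
  assumes "finite \<Omega>" "stochastic_on \<Omega> P"
  shows "stochastic_on \<Omega> (mat_power \<Omega> P t)"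
proof (induction t)
  case 0
  then show ?case using assms(1) by (simp add: stochastic_on_def)
next
  case (Suc t)
  have "(\<Sum>y\<in>\<Omega>. mat_power \<Omega> P (Suc t) x y) = 1" if "x \<in> \<Omega>" for x
    using sum_vector_matrix[OF assms(2), of "mat_power \<Omega> P t x"] stochastic_onD(2)[OF Suc that]
    by simp
  moreover have "0 \<le> mat_power \<Omega> P (Suc t) x y" if "x \<in> \<Omega>" "y \<in> \<Omega>" for x y
    using that by (auto intro!: sum_nonneg mult_nonneg_nonneg stochastic_onD(1)[OF Suc]
        stochastic_onD(1)[OF assms(2)])
  ultimately show ?case by (simp add: stochastic_on_def)
qed

lemma mat_power_add:
  assumes "finite \<Omega>" "y \<in> \<Omega>"
  shows "mat_power \<Omega> P (s + t) x y = (\<Sum>z\<in>\<Omega>. mat_power \<Omega> P s x z * mat_power \<Omega> P t z y)"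
  using assms(2)
proof (induction t arbitrary: y)
  case 0
  then show ?case using assms(1) by (simp add: if_distrib cong: if_cong)
next
  case (Suc t)
  have "mat_power \<Omega> P (s + Suc t) x y =
      (\<Sum>w\<in>\<Omega>. \<Sum>z\<in>\<Omega>. mat_power \<Omega> P s x z * mat_power \<Omega> P t z w * P w y)"
    by (simp add: Suc.IH sum_distrib_right)
  also have "\<dots> = (\<Sum>z\<in>\<Omega>. mat_power \<Omega> P s x z * mat_power \<Omega> P (Suc t) z y)"
    by (subst sum.swap) (simp add: sum_distrib_left mult.assoc)
  finally show ?case .
qed

lemma vector_mat_power_add:
  assumes "finite \<Omega>" "y \<in> \<Omega>"
  shows "(\<Sum>x\<in>\<Omega>. f x * mat_power \<Omega> P (s + t) x y) =
    (\<Sum>z\<in>\<Omega>. (\<Sum>x\<in>\<Omega>. f x * mat_power \<Omega> P s x z) * mat_power \<Omega> P t z y)"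
  unfolding mat_power_add[OF assms] sum_distrib_left sum_distrib_right
  by (subst sum.swap) (simp add: mult.assoc)

text \<open>Only the trajectories through \<open>y\<close> at time \<open>t\<close> are kept;
  chaining the bound estimates the probability of one fixed path.\<close>

lemma mat_power_Suc_ge:
  assumes "finite \<Omega>" "stochastic_on \<Omega> P" "x \<in> \<Omega>" "y \<in> \<Omega>" "z \<in> \<Omega>"
  shows "mat_power \<Omega> P t x y * P y z \<le> mat_power \<Omega> P (Suc t) x z"
  using assms stochastic_onD(1)[OF stochastic_on_mat_power[OF assms(1,2), of t] assms(3)]
    stochastic_onD(1)[OF assms(2)]
  by (auto intro!: member_le_sum mult_nonneg_nonneg)

lemma doeblin_contraction:
  assumes "finite \<Omega>" "stochastic_on \<Omega> Q" "z \<in> \<Omega>" "\<And>x. x \<in> \<Omega> \<Longrightarrow> \<delta> \<le> Q x z"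
    and f: "(\<Sum>x\<in>\<Omega>. f x) = 0"
  shows "(\<Sum>y\<in>\<Omega>. \<bar>\<Sum>x\<in>\<Omega>. f x * Q x y\<bar>) \<le> (1 - \<delta>) * (\<Sum>x\<in>\<Omega>. \<bar>f x\<bar>)"
proof -
  \<comment> \<open>Since \<open>f\<close> has mass 0, subtracting \<open>\<delta>\<close> from the column of \<open>z\<close> does not change \<open>f Q\<close>.\<close>
  define R where "R x y = Q x y - (if y = z then \<delta> else 0)" for x y
  have R: "0 \<le> R x y" if "x \<in> \<Omega>" "y \<in> \<Omega>" for x y
    using that assms(4) stochastic_onD(1)[OF assms(2)] by (auto simp: R_def)
  have row: "(\<Sum>y\<in>\<Omega>. R x y) = 1 - \<delta>" if "x \<in> \<Omega>" for x
    using that assms(1,3) by (simp add: R_def sum_subtractf stochastic_onD(2)[OF assms(2)])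
  have eq: "(\<Sum>x\<in>\<Omega>. f x * Q x y) = (\<Sum>x\<in>\<Omega>. f x * R x y)" for y
    using f by (simp add: R_def right_diff_distrib sum_subtractf flip: sum_distrib_right)
  have "(\<Sum>y\<in>\<Omega>. \<bar>\<Sum>x\<in>\<Omega>. f x * Q x y\<bar>) \<le> (\<Sum>y\<in>\<Omega>. \<Sum>x\<in>\<Omega>. \<bar>f x\<bar> * R x y)"
    unfolding eq using R by (intro sum_mono order_trans[OF sum_abs]) (simp add: abs_mult)
  \<comment> \<open>The contraction factor is the common row sum of \<open>R\<close>.\<close>
  also have "\<dots> = (\<Sum>x\<in>\<Omega>. \<bar>f x\<bar> * (1 - \<delta>))"
    by (subst sum.swap) (simp add: row flip: sum_distrib_left)
  finally show ?thesis by (simp add: mult.commute flip: sum_distrib_right)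
qed

text \<open>The case \<delta> = 0 of Doeblin's bound, where the minorization is mere nonnegativity
  of a column. It absorbs the steps that do not fill a block of length \<open>r\<close>.\<close>

lemma stochastic_contraction:
  assumes "finite \<Omega>" "stochastic_on \<Omega> Q" "(\<Sum>x\<in>\<Omega>. f x) = 0"
  shows "(\<Sum>y\<in>\<Omega>. \<bar>\<Sum>x\<in>\<Omega>. f x * Q x y\<bar>) \<le> (\<Sum>x\<in>\<Omega>. \<bar>f x\<bar>)"
proof (cases "\<Omega> = {}")
  case False
  then obtain z where "z \<in> \<Omega>" by blast
  then show ?thesis
    using doeblin_contraction[OF assms(1,2), of z 0 f] assms(3) stochastic_onD(1)[OF assms(2)] by simp
qed simp

section \<open>Convergence under a Doeblin condition at a single state\<close>

locale doeblin_chain =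
  fixes \<Omega> :: "'a set" and P :: "'a \<Rightarrow> 'a \<Rightarrow> real" and r :: nat and \<delta> :: real and z :: 'a
  assumes finite_states: "finite \<Omega>" and stochastic: "stochastic_on \<Omega> P" and atom: "z \<in> \<Omega>"
    and pos: "0 < \<delta>" and minorization: "\<And>x. x \<in> \<Omega> \<Longrightarrow> \<delta> \<le> mat_power \<Omega> P r x z"
begin

lemmas stochastic_power = stochastic_on_mat_power[OF finite_states stochastic]

text \<open>An entry of a stochastic row is at most the row sum. Hence \<open>1 - \<delta>\<close>
  is nonnegative and inequalities can be multiplied by its powers.\<close>

lemma delta_le_1: "\<delta> \<le> 1"
proof -
  have "mat_power \<Omega> P r z z \<le> (\<Sum>y\<in>\<Omega>. mat_power \<Omega> P r z y)"
    using finite_states stochastic_onD(1)[OF stochastic_power atom] atom by (intro member_le_sum) auto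
  then show ?thesis
    using minorization[OF atom] stochastic_onD(2)[OF stochastic_power atom, of r] by linarith
qed

text \<open>Each block of \<open>r\<close> steps gains one factor. Asking only for
  \<open>r * k \<le> s\<close> makes the bound uniform over all later times, as the Cauchy argument
  requires.\<close>

lemma power_contraction:
  assumes f: "(\<Sum>x\<in>\<Omega>. f x) = 0" and "r * k \<le> s"
  shows "(\<Sum>y\<in>\<Omega>. \<bar>\<Sum>x\<in>\<Omega>. f x * mat_power \<Omega> P s x y\<bar>) \<le> (1 - \<delta>) ^ k * (\<Sum>x\<in>\<Omega>. \<bar>f x\<bar>)"
  using assms(2)
proof (induction k arbitrary: s)
  case 0
  then show ?case using stochastic_contraction[OF finite_states stochastic_power f] by simp
next
  case (Suc k)
  define s' where "s' = s - r"
  have s: "s = s' + r" and le: "r * k \<le> s'" using Suc.prems by (simp_all add: s'_def)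
  define g where "g y = (\<Sum>x\<in>\<Omega>. f x * mat_power \<Omega> P s' x y)" for y
  have g: "(\<Sum>y\<in>\<Omega>. g y) = 0"
    unfolding g_def using sum_vector_matrix[OF stochastic_power] f by simp
  have "(\<Sum>y\<in>\<Omega>. \<bar>\<Sum>x\<in>\<Omega>. f x * mat_power \<Omega> P s x y\<bar>) =
      (\<Sum>y\<in>\<Omega>. \<bar>\<Sum>x\<in>\<Omega>. g x * mat_power \<Omega> P r x y\<bar>)"
    by (simp add: s g_def vector_mat_power_add[OF finite_states])
  also have "\<dots> \<le> (1 - \<delta>) * (\<Sum>x\<in>\<Omega>. \<bar>g x\<bar>)"
    by (rule doeblin_contraction[OF finite_states stochastic_power atom minorization g])
  also have "\<dots> \<le> (1 - \<delta>) * ((1 - \<delta>) ^ k * (\<Sum>x\<in>\<Omega>. \<bar>f x\<bar>))"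
    unfolding g_def using Suc.IH[OF le] delta_le_1 by (intro mult_left_mono) auto
  finally show ?case by (simp add: mult.assoc)
qed

text \<open>The point mass at \<open>x\<close> minus \<open>\<nu>\<close> has mass 0 and norm at
  most 2. As \<open>\<nu>\<close> is any distribution, it can be a later law of the chain (for
  convergence) or a stationary one (for mixing).\<close>

lemma power_near_invariant:
  assumes x: "x \<in> \<Omega>" and \<nu>: "\<And>y. y \<in> \<Omega> \<Longrightarrow> 0 \<le> \<nu> y" "(\<Sum>y\<in>\<Omega>. \<nu> y) = 1" and "r * k \<le> s"
  shows "(\<Sum>y\<in>\<Omega>. \<bar>mat_power \<Omega> P s x y - (\<Sum>w\<in>\<Omega>. \<nu> w * mat_power \<Omega> P s w y)\<bar>) \<le> 2 * (1 - \<delta>) ^ k"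
proof -
  define f where "f w = (if x = w then 1 else 0) - \<nu> w" for w
  have f: "(\<Sum>w\<in>\<Omega>. f w) = 0"
    using x finite_states \<nu>(2) by (simp add: f_def sum_subtractf)
  have "(\<Sum>w\<in>\<Omega>. \<bar>f w\<bar>) \<le> (\<Sum>w\<in>\<Omega>. (if x = w then 1 else 0) + \<nu> w)"
    using \<nu>(1) x by (intro sum_mono) (force simp: f_def abs_le_iff)
  also have "\<dots> = 2" using x finite_states \<nu>(2) by (simp add: sum.distrib)
  finally have norm: "(\<Sum>w\<in>\<Omega>. \<bar>f w\<bar>) \<le> 2" .
  have "(\<Sum>w\<in>\<Omega>. f w * mat_power \<Omega> P s w y) =
      mat_power \<Omega> P s x y - (\<Sum>w\<in>\<Omega>. \<nu> w * mat_power \<Omega> P s w y)" for y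
    using x finite_states
    by (simp add: f_def left_diff_distrib sum_subtractf if_distrib[of "\<lambda>c. c * _"] cong: if_cong)
  then have "(\<Sum>y\<in>\<Omega>. \<bar>mat_power \<Omega> P s x y - (\<Sum>w\<in>\<Omega>. \<nu> w * mat_power \<Omega> P s w y)\<bar>) \<le>
      (1 - \<delta>) ^ k * (\<Sum>w\<in>\<Omega>. \<bar>f w\<bar>)"
    using power_contraction[OF f assms(4)] by simp
  also have "\<dots> \<le> (1 - \<delta>) ^ k * 2"
    using norm delta_le_1 by (intro mult_left_mono) auto
  finally show ?thesis by simp
qed

lemma Cauchy_mat_power:
  assumes y: "y \<in> \<Omega>"
  shows "Cauchy (\<lambda>t. mat_power \<Omega> P t z y)"
proof (rule CauchyI')
  fix e :: real
  assume "0 < e"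
  then obtain k where k: "(1 - \<delta>) ^ k < e / 2"
    using real_arch_pow_inv[of "e / 2" "1 - \<delta>"] pos by auto
  have "dist (mat_power \<Omega> P s z y) (mat_power \<Omega> P t z y) < e" if "r * k \<le> s" "s < t" for s t
  proof -
    \<comment> \<open>The law at time \<open>t\<close> is the law at time \<open>t - s\<close> run
      for \<open>s\<close> more steps, so that \<open>power_near_invariant\<close> applies with the
      former as \<open>\<nu>\<close>.\<close>
    have t: "t = (t - s) + s" using that by simp
    let ?d = "\<lambda>y. mat_power \<Omega> P s z y - mat_power \<Omega> P t z y"
    have "\<bar>?d y\<bar> \<le> (\<Sum>y\<in>\<Omega>. \<bar>?d y\<bar>)"
      using y finite_states by (intro member_le_sum) auto
    also have "\<dots> = (\<Sum>y\<in>\<Omega>. \<bar>mat_power \<Omega> P s z y -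
        (\<Sum>w\<in>\<Omega>. mat_power \<Omega> P (t - s) z w * mat_power \<Omega> P s w y)\<bar>)"
      by (subst t) (simp add: mat_power_add[OF finite_states] del: le_add_diff_inverse2)
    also have "\<dots> \<le> 2 * (1 - \<delta>) ^ k"
      using stochastic_onD[OF stochastic_power atom] that(1) atom
      by (intro power_near_invariant) auto
    finally show ?thesis using k by (simp add: dist_real_def)
  qed
  then show "\<exists>M. \<forall>m\<ge>M. \<forall>n>m. dist (mat_power \<Omega> P m z y) (mat_power \<Omega> P n z y) < e"
    by blast
qed

text \<open>The limit law of the chain started at \<open>z\<close> is invariant, because a
  convergent sequence and its shift by one step have the same limit.\<close>

lemma stationary_exists: "\<exists>\<pi>. is_stationary \<Omega> P \<pi>"
proof -
  define \<pi> where "\<pi> y = (if y \<in> \<Omega> then lim (\<lambda>t. mat_power \<Omega> P t z y) else 0)" for y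
  have lim: "(\<lambda>t. mat_power \<Omega> P t z y) \<longlonglongrightarrow> \<pi> y" if "y \<in> \<Omega>" for y
    using Cauchy_mat_power[OF that] that by (simp add: \<pi>_def Cauchy_convergent_iff convergent_LIMSEQ_iff)
  have "0 \<le> \<pi> y" if "y \<in> \<Omega>" for y
    using stochastic_onD(1)[OF stochastic_power atom that] by (intro LIMSEQ_le_const[OF lim[OF that]]) auto
  moreover have "(\<Sum>y\<in>\<Omega>. \<pi> y) = 1"
  proof (rule LIMSEQ_unique)
    show "(\<lambda>t. \<Sum>y\<in>\<Omega>. mat_power \<Omega> P t z y) \<longlonglongrightarrow> (\<Sum>y\<in>\<Omega>. \<pi> y)"
      by (intro tendsto_sum lim)
    show "(\<lambda>t. \<Sum>y\<in>\<Omega>. mat_power \<Omega> P t z y) \<longlonglongrightarrow> 1"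
      by (simp add: stochastic_onD(2)[OF stochastic_power atom])
  qed
  moreover have "(\<Sum>x\<in>\<Omega>. \<pi> x * P x y) = \<pi> y" if "y \<in> \<Omega>" for y
  proof (rule LIMSEQ_unique)
    show "(\<lambda>t. mat_power \<Omega> P (Suc t) z y) \<longlonglongrightarrow> (\<Sum>x\<in>\<Omega>. \<pi> x * P x y)"
      unfolding mat_power.simps by (intro tendsto_sum tendsto_mult lim tendsto_const)
    show "(\<lambda>t. mat_power \<Omega> P (Suc t) z y) \<longlonglongrightarrow> \<pi> y"
      by (rule LIMSEQ_Suc[OF lim[OF that]])
  qed
  ultimately have "is_stationary \<Omega> P \<pi>" by (simp add: is_stationary_def \<pi>_def)
  then show ?thesis by blast
qed

lemma stationary_mat_power:
  assumes "is_stationary \<Omega> P \<pi>" "y \<in> \<Omega>"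
  shows "(\<Sum>x\<in>\<Omega>. \<pi> x * mat_power \<Omega> P t x y) = \<pi> y"
  using assms(2)
proof (induction t arbitrary: y)
  case 0
  then show ?case using finite_states by (simp add: if_distrib cong: if_cong)
next
  case (Suc t)
  have "(\<Sum>x\<in>\<Omega>. \<pi> x * mat_power \<Omega> P (Suc t) x y) =
      (\<Sum>w\<in>\<Omega>. (\<Sum>x\<in>\<Omega>. \<pi> x * mat_power \<Omega> P t x w) * P w y)"
    unfolding mat_power.simps sum_distrib_left sum_distrib_right
    by (subst sum.swap) (simp add: mult.assoc)
  then show ?case using Suc assms(1) by (simp add: is_stationary_def)
qed

text \<open>The difference is fixed by the \<open>r\<close>-step matrix, yet its norm shrinks by
  \<open>1 - \<delta> < 1\<close>, so it vanishes on \<open>\<Omega>\<close>. Outside, both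
  functions are 0 by definition.\<close>

lemma stationary_unique:
  assumes \<pi>: "is_stationary \<Omega> P \<pi>" and \<rho>: "is_stationary \<Omega> P \<rho>"
  shows "\<pi> = \<rho>"
proof -
  let ?f = "\<lambda>x. \<pi> x - \<rho> x"
  have "(\<Sum>x\<in>\<Omega>. ?f x) = 0"
    using \<pi> \<rho> by (simp add: is_stationary_def sum_subtractf)
  from power_contraction[OF this, of 1 r]
  have "(\<Sum>y\<in>\<Omega>. \<bar>?f y\<bar>) \<le> (1 - \<delta>) * (\<Sum>y\<in>\<Omega>. \<bar>?f y\<bar>)"
    using stationary_mat_power[OF \<pi>] stationary_mat_power[OF \<rho>]
    by (simp add: left_diff_distrib sum_subtractf)
  then have "\<delta> * (\<Sum>y\<in>\<Omega>. \<bar>?f y\<bar>) \<le> 0" by (simp add: algebra_simps)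
  then have "(\<Sum>y\<in>\<Omega>. \<bar>?f y\<bar>) = 0"
    using pos by (simp add: mult_le_0_iff sum_nonneg antisym)
  then have "\<pi> x = \<rho> x" if "x \<in> \<Omega>" for x
    using that finite_states by (simp add: sum_nonneg_eq_0_iff)
  moreover have "\<pi> x = \<rho> x" if "x \<notin> \<Omega>" for x
    using that \<pi> \<rho> by (simp add: is_stationary_def)
  ultimately show ?thesis by blast
qed

section \<open>From contraction to a mixing time bound\<close>

lemma is_stationary_stationary_distribution:
  "is_stationary \<Omega> P (stationary_distribution \<Omega> P)"
  unfolding stationary_distribution_def
  using stationary_exists stationary_unique by (metis theI)

text \<open>Total variation is bounded by the full norm of the difference; the sharper factor 1/2 is
  given up.\<close>

lemma tv_distance_le:
  assumes "x \<in> \<Omega>"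
  shows "tv_distance \<Omega> (mat_power \<Omega> P (r * k) x) (stationary_distribution \<Omega> P) \<le> 2 * (1 - \<delta>) ^ k"
proof -
  let ?\<mu> = "mat_power \<Omega> P (r * k) x" and ?\<pi> = "stationary_distribution \<Omega> P"
  note \<pi> = is_stationary_stationary_distribution
  have l1: "(\<Sum>y\<in>\<Omega>. \<bar>?\<mu> y - ?\<pi> y\<bar>) \<le> 2 * (1 - \<delta>) ^ k"
    using power_near_invariant[OF assms, of ?\<pi> k "r * k"] \<pi> stationary_mat_power[OF \<pi>]
    by (simp add: is_stationary_def)
  have "\<bar>(\<Sum>y\<in>A. ?\<mu> y) - (\<Sum>y\<in>A. ?\<pi> y)\<bar> \<le> 2 * (1 - \<delta>) ^ k" if "A \<subseteq> \<Omega>" for A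
  proof -
    have "\<bar>(\<Sum>y\<in>A. ?\<mu> y) - (\<Sum>y\<in>A. ?\<pi> y)\<bar> \<le> (\<Sum>y\<in>A. \<bar>?\<mu> y - ?\<pi> y\<bar>)"
      by (simp add: sum_abs flip: sum_subtractf)
    also have "\<dots> \<le> (\<Sum>y\<in>\<Omega>. \<bar>?\<mu> y - ?\<pi> y\<bar>)"
      using that finite_states by (intro sum_mono2) auto
    finally show ?thesis using l1 by linarith
  qed
  then show ?thesis
    unfolding tv_distance_def using finite_states by (intro Max.boundedI) auto
qed

lemma mixing_time_le:
  assumes "2 * (1 - \<delta>) ^ k \<le> 1 / 4"
  shows "mixing_time \<Omega> P \<le> enat (r * k)"
proof -
  have "Max ((\<lambda>x. tv_distance \<Omega> (mat_power \<Omega> P (r * k) x) (stationary_distribution \<Omega> P)) ` \<Omega>) \<le> 1 / 4"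
    using finite_states atom order_trans[OF tv_distance_le assms] by (intro Max.boundedI) auto
  then show ?thesis
    unfolding mixing_time_def by (intro Inf_lower) simp
qed

end

section \<open>Logit dynamics\<close>

lemma profiles_upd: "x \<in> profiles n S \<Longrightarrow> i < n \<Longrightarrow> y \<in> S i \<Longrightarrow> x(i := y) \<in> profiles n S"
  by (auto simp: profiles_def PiE_iff extensional_def)

lemma finite_profiles: "(\<And>i. i < n \<Longrightarrow> finite (S i)) \<Longrightarrow> finite (profiles n S)"
  by (auto simp: profiles_def intro: finite_PiE)

lemma logit_choice_nonneg: "0 \<le> logit_choice S u \<beta> i x y"
  by (simp add: logit_choice_def sum_nonneg)

lemma sum_logit_choice:
  assumes "finite (S i)" "S i \<noteq> {}"
  shows "(\<Sum>y\<in>S i. logit_choice S u \<beta> i x y) = 1"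
proof -
  have "0 < (\<Sum>z\<in>S i. exp (\<beta> * u i (x(i := z))))" using assms by (intro sum_pos) auto
  then show ?thesis by (simp add: logit_choice_def flip: sum_divide_distrib)
qed

lemma stochastic_on_logit_matrix:
  assumes "0 < n" and S: "\<And>i. i < n \<Longrightarrow> finite (S i)" "\<And>i. i < n \<Longrightarrow> S i \<noteq> {}"
  shows "stochastic_on (profiles n S) (logit_matrix n S u \<beta>)"
  unfolding stochastic_on_def
proof (intro conjI ballI)
  fix x assume x: "x \<in> profiles n S"
  have "(\<Sum>x'\<in>profiles n S. \<Sum>y\<in>{y \<in> S i. x(i := y) = x'}. logit_choice S u \<beta> i x y) = 1"
    if "i < n" for i
    \<comment> \<open>The strategies in \<open>S i\<close> are grouped by the profile to which they
      lead.\<close>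
    using sum.group[of "S i" "profiles n S" "\<lambda>y. x(i := y)" "logit_choice S u \<beta> i x"]
      that S finite_profiles[of n S] profiles_upd[OF x that] sum_logit_choice[of S i u \<beta> x] by auto
  then show "(\<Sum>x'\<in>profiles n S. logit_matrix n S u \<beta> x x') = 1"
    unfolding logit_matrix_def using \<open>0 < n\<close>
    by (subst sum.swap) (simp flip: sum_divide_distrib)
qed (auto simp: logit_matrix_def intro!: sum_nonneg divide_nonneg_nonneg logit_choice_nonneg)

text \<open>Equality can fail when \<open>y\<close> is already \<open>x i\<close>: other players may
  contribute by keeping their strategies.\<close>

lemma logit_matrix_upd_ge:
  assumes "i < n" "finite (S i)" "y \<in> S i"
  shows "logit_choice S u \<beta> i x y / real n \<le> logit_matrix n S u \<beta> x (x(i := y))"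
proof -
  let ?c = "\<lambda>j. 1 / real n * (\<Sum>w\<in>{w \<in> S j. x(j := w) = x(i := y)}. logit_choice S u \<beta> j x w)"
  have "logit_choice S u \<beta> i x y \<le>
      (\<Sum>w\<in>{w \<in> S i. x(i := w) = x(i := y)}. logit_choice S u \<beta> i x w)"
    using assms by (intro member_le_sum) (auto simp: logit_choice_nonneg)
  then have "logit_choice S u \<beta> i x y / real n \<le> ?c i"
    using assms(1) by (simp add: divide_right_mono)
  also have "\<dots> \<le> (\<Sum>j<n. ?c j)"
    using assms(1) by (intro member_le_sum) (auto intro!: divide_nonneg_nonneg sum_nonneg logit_choice_nonneg)
  finally show ?thesis by (simp add: logit_matrix_def)
qed

text \<open>A single path suffices: players 0 to \<open>n - 1\<close> are selected in this order and
  each adopts her entry of \<open>a\<close>, every step having probability at least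
  \<open>c / n\<close>.\<close>

lemma logit_mat_power_ge:
  assumes S: "\<And>i. i < n \<Longrightarrow> finite (S i)" and x: "x \<in> profiles n S" and a: "a \<in> profiles n S"
    and "0 \<le> c"
    and c: "\<And>i x. i < n \<Longrightarrow> x \<in> profiles n S \<Longrightarrow> c \<le> logit_choice S u \<beta> i x (a i)"
  shows "(c / n) ^ n \<le> mat_power (profiles n S) (logit_matrix n S u \<beta>) n x a"
proof (cases "n = 0")
  case True
  \<comment> \<open>Without players there is only one profile, and both sides are 1.\<close>
  then show ?thesis using x a by (simp add: profiles_def)
next
  case False
  let ?P = "logit_matrix n S u \<beta>" and ?\<Omega> = "profiles n S"
  \<comment> \<open>The profile on the path after the first \<open>m\<close> players have
    moved.\<close>
  define b where "b m = (\<lambda>i. if i < m then a i else x i)" for m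
  have a_mem: "a i \<in> S i" if "i < n" for i using a that by (auto simp: profiles_def)
  have stoch: "stochastic_on ?\<Omega> ?P"
    using False S a_mem by (intro stochastic_on_logit_matrix) auto
  have b: "b m \<in> ?\<Omega>" if "m \<le> n" for m
    using a x that by (auto simp: b_def profiles_def PiE_iff extensional_def)
  have "(c / n) ^ m \<le> mat_power ?\<Omega> ?P m x (b m)" if "m \<le> n" for m
    using that
  proof (induction m)
    case 0
    then show ?case by (simp add: b_def)
  next
    case (Suc m)
    have step: "b (Suc m) = (b m)(m := a m)" by (auto simp: b_def fun_eq_iff)
    have "c / n \<le> logit_choice S u \<beta> m (b m) (a m) / n"
      using Suc.prems b[of m] by (intro divide_right_mono c) auto
    also have "\<dots> \<le> ?P (b m) (b (Suc m))"
      unfolding step using Suc.prems S a_mem by (intro logit_matrix_upd_ge) auto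
    finally have "(c / n) ^ m * (c / n) \<le> mat_power ?\<Omega> ?P m x (b m) * ?P (b m) (b (Suc m))"
      using Suc \<open>0 \<le> c\<close> by (intro mult_mono order_trans[OF _ Suc.IH]) auto
    also have "\<dots> \<le> mat_power ?\<Omega> ?P (Suc m) x (b (Suc m))"
      using Suc.prems by (intro mat_power_Suc_ge finite_profiles S stoch x b) auto
    finally show ?case by (simp add: mult.commute)
  qed
  \<comment> \<open>From index \<open>n\<close> on, \<open>x\<close> and \<open>a\<close> agree
    because profiles are extensional.\<close>
  moreover have "b n = a"
    using a x by (auto simp: b_def fun_eq_iff profiles_def PiE_iff extensional_def)
  ultimately show ?thesis by (metis order_refl)
qed

section \<open>The CK game\<close>

text \<open>Indicators replace the cardinality, so that simplification can evaluate costs in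
  concrete profiles.\<close>

lemma ck_cost_eq:
  "ck_cost x f = of_bool (f \<in> ck_selects 0 (x 0)) + of_bool (f \<in> ck_selects 1 (x 1)) +
    of_bool (f \<in> ck_selects 2 (x 2))"
proof -
  have "{j. j < 3 \<and> f \<in> ck_selects j (x j)} = {j \<in> {0, 1, 2}. f \<in> ck_selects j (x j)}" by auto
  also have "card \<dots> = (\<Sum>j\<in>{0, 1, 2}. of_bool (f \<in> ck_selects j (x j)))"
    by (simp add: Int_def of_bool_def sum.If_cases)
  finally show ?thesis unfolding ck_cost_def by simp
qed

lemma ck_zero_dominant:
  assumes "i < 3" "x \<in> profiles 3 ck_strategies"
  shows "ck_utility i (x(i := 1)) \<le> ck_utility i (x(i := 0))"
proof -
  have x: "x j = 0 \<or> x j = 1" if "j < 3" for j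
    using assms(2) that by (auto simp: profiles_def ck_strategies_def)
  have "i = 0 \<or> i = 1 \<or> i = 2" using assms(1) by auto
  \<comment> \<open>Finite check over the player and the eight profiles.\<close>
  then show ?thesis
    using x[of 0] x[of 1] x[of 2]
    by (elim disjE) (simp_all add: ck_utility_def ck_cost_eq ck_selects_def)
qed

text \<open>For \<beta> \<ge> 0 dominance orders the two exponential weights. The value 1/2 is
  attained when both other players use strategy 1, since the costs then tie.\<close>

lemma ck_logit_choice_zero_ge:
  assumes "0 \<le> \<beta>" "i < 3" "x \<in> profiles 3 ck_strategies"
  shows "1 / 2 \<le> logit_choice ck_strategies ck_utility \<beta> i x 0"
proof -
  have "exp (\<beta> * ck_utility i (x(i := 1))) \<le> exp (\<beta> * ck_utility i (x(i := 0)))"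
    using ck_zero_dominant[OF assms(2,3)] assms(1) by (simp add: mult_left_mono)
  moreover have "0 < exp (\<beta> * ck_utility i (x(i := 1)))" "0 < exp (\<beta> * ck_utility i (x(i := 0)))"
    by simp_all
  ultimately show ?thesis
    by (simp add: logit_choice_def ck_strategies_def field_simps del: exp_gt_zero)
qed

theorem theorem7:
  "\<exists>\<tau>::nat. \<forall>\<beta>::real. 0 \<le> \<beta> \<longrightarrow>
     logit_mixing_time 3 ck_strategies ck_utility \<beta> \<le> enat \<tau>"
proof -
  \<comment> \<open>Here 1/216 is \<open>((1/2) / 3) ^ 3\<close>, and 1/8 turns the bound
    \<open>2 * (1 - \<delta>) ^ k\<close> into 1/4. The choice of \<open>k\<close> precedes that of
    \<open>\<beta>\<close>, which gives uniformity.\<close>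
  obtain k where k: "(1 - 1 / 216 :: real) ^ k < 1 / 8"
    using real_arch_pow_inv[of "1 / 8" "1 - 1 / 216 :: real"] by auto
  \<comment> \<open>The restricted abstraction makes the all-zero profile extensional, as membership
    in \<open>profiles\<close> demands.\<close>
  let ?a = "\<lambda>i\<in>{..<3}. 0 :: nat"
  have a: "?a \<in> profiles 3 ck_strategies" by (simp add: profiles_def ck_strategies_def)
  have "logit_mixing_time 3 ck_strategies ck_utility \<beta> \<le> enat (3 * k)" if \<beta>: "0 \<le> \<beta>" for \<beta>
  proof -
    interpret doeblin_chain "profiles 3 ck_strategies" "logit_matrix 3 ck_strategies ck_utility \<beta>"
      3 "1 / 216" ?a
    proof
      fix x assume "x \<in> profiles 3 ck_strategies"
      from logit_mat_power_ge[OF _ this a, of "1 / 2" ck_utility \<beta>]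
      show "1 / 216 \<le> mat_power (profiles 3 ck_strategies)
          (logit_matrix 3 ck_strategies ck_utility \<beta>) 3 x ?a"
        using ck_logit_choice_zero_ge[OF \<beta>] by (simp add: ck_strategies_def power3_eq_cube)
    qed (use a in \<open>auto intro!: finite_profiles stochastic_on_logit_matrix simp: ck_strategies_def\<close>)
    show ?thesis unfolding logit_mixing_time_def using k by (intro mixing_time_le) simp
  qed
  then show ?thesis by blast
qed

end
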